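(* Let $X=X^\top>0$, $Y=Y^\top>0$ be real $n\times n$ matrices, let $\gamma>0$, and put $Q:=X^{-1}>0$ and $\tilde Y:=QYQ$. Then the matrix inequality $$\begin{bmatrix} -X+Y & 0 & 0 & \bar A^\top\\ 0&-Y&0&\bar A_d^\top\\ 0&0&-\gamma^2 I_p&\bar D^\top\\ \bar A&\bar A_d&\bar D&-X^{-1}\end{bmatrix}<0$$ is equivalent, via the congruence by $\Sigma=\mathrm{diag}(Q,Q,I_p,I_n)$, to $$\begin{bmatrix} -Q+\tilde Y & 0 & 0 & Q\bar A^\top\\ 0&-\tilde Y&0&Q\bar A_d^\top\\ 0&0&-\gamma^2 I_p&\bar D^\top\\ \bar AQ&\bar A_dQ&\bar D&-Q\end{bmatrix}<0,$$ where all blocks involving $Q$ and $\tilde Y$ in the second matrix are affine in $(Q,\tilde Y)$.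
   Context: Standing setting: $n=m=p$; $A,A_d\in\mathbb{R}^{n\times n}$, $B\in\mathbb{R}^{n\times m}$, $C\in\mathbb{R}^{m\times n}$, $D\in\mathbb{R}^{n\times p}$. $P:M_n(\mathbb{C})\to M_n(\mathbb{C})$ is a Rota-Baxter operator of weight $\lambda\in\mathbb{R}$, i.e. a linear map with $P(x)P(y)=P(xP(y))+P(P(x)y)+\lambda P(xy)$ for all $x,y$. The deformed matrices are $A_P:=P(A)$, $A_{d,P}:=P(A_d)$, $B_P:=P(B)$, taken to be real, and $CB_P$ is assumed invertible. Set $\Pi:=I-B_P(CB_P)^{-1}C$, $\bar A:=\Pi A_P$, $\bar A_d:=\Pi A_{d,P}$, $\bar D:=\Pi D$ (fixed matrices). For a symmetric matrix $S$, $S<0$ means negative definite and $S>0$ positive definite. *)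

theory Defs
  imports "HOL-Analysis.Analysis"
begin

definition pos_def :: "real^'k^'k \<Rightarrow> bool" where
  "pos_def S \<longleftrightarrow> transpose S = S \<and> (\<forall>x. x \<noteq> 0 \<longrightarrow> x \<bullet> (S *v x) > 0)"

definition neg_def :: "real^'k^'k \<Rightarrow> bool" where
  "neg_def S \<longleftrightarrow> transpose S = S \<and> (\<forall>x. x \<noteq> 0 \<longrightarrow> x \<bullet> (S *v x) < 0)"

text \<open>Linearity is over the complex numbers: \<open>map_matrix ((*) c)\<close> is the scalar multiple
  of a matrix by \<open>c\<close>.\<close>

definition rota_baxter :: "real \<Rightarrow> (complex^'n^'n \<Rightarrow> complex^'n^'n) \<Rightarrow> bool" where
  "rota_baxter w P \<longleftrightarrow>
     Vector_Spaces.linear (\<lambda>c. map_matrix ((*) c)) (\<lambda>c. map_matrix ((*) c)) P \<and>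
     (\<forall>x y. P x ** P y = P (x ** P y) + P (P x ** y) + w *\<^sub>R P (x ** y))"

abbreviation complexify :: "real^'n^'n \<Rightarrow> complex^'n^'n" where
  "complexify \<equiv> map_matrix complex_of_real"

text \<open>Since all blocks are square of the same size, a block matrix is a matrix of matrices;
  \<open>block_mat\<close> flattens a \<open>4 \<times> 4\<close> block array to an ordinary \<open>4n \<times> 4n\<close> matrix, with rows and
  columns indexed by pairs (block, position in the block).\<close>

definition block_mat :: "real^'n^'n^4^4 \<Rightarrow> real^(4 \<times> 'n)^(4 \<times> 'n)" where
  "block_mat M = (\<chi> i j. M $ fst i $ fst j $ snd i $ snd j)"

definition lmi_XY ::
  "real^'n^'n \<Rightarrow> real^'n^'n \<Rightarrow> real^'n^'n \<Rightarrow> real \<Rightarrow> real^'n^'n \<Rightarrow> real^'n^'n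
    \<Rightarrow> real^'n^'n^4^4" where
  "lmi_XY Ab Adb Db \<gamma> X Y = vector [
     vector [- X + Y, 0,   0,                          transpose Ab],
     vector [0,       - Y, 0,                          transpose Adb],
     vector [0,       0,   - (\<gamma>\<^sup>2 *\<^sub>R mat 1), transpose Db],
     vector [Ab,      Adb, Db,                         - matrix_inv X]]"

definition lmi_QY ::
  "real^'n^'n \<Rightarrow> real^'n^'n \<Rightarrow> real^'n^'n \<Rightarrow> real \<Rightarrow> real^'n^'n \<Rightarrow> real^'n^'n
    \<Rightarrow> real^'n^'n^4^4" where
  "lmi_QY Ab Adb Db \<gamma> Q Yt = vector [
     vector [- Q + Yt, 0,        0,                          Q ** transpose Ab],
     vector [0,        - Yt,     0,                          Q ** transpose Adb],
     vector [0,        0,        - (\<gamma>\<^sup>2 *\<^sub>R mat 1), transpose Db],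
     vector [Ab ** Q,  Adb ** Q, Db,                         - Q]]"

definition block_diag ::
  "real^'n^'n \<Rightarrow> real^'n^'n \<Rightarrow> real^'n^'n \<Rightarrow> real^'n^'n \<Rightarrow> real^'n^'n^4^4" where
  "block_diag E F G H = vector [
     vector [E, 0, 0, 0],
     vector [0, F, 0, 0],
     vector [0, 0, G, 0],
     vector [0, 0, 0, H]]"

definition affine_map :: "('a::real_vector \<Rightarrow> 'b::real_vector) \<Rightarrow> bool" where
  "affine_map f \<longleftrightarrow> (\<exists>L c. linear L \<and> (\<forall>x. f x = L x + c))"

end

theory Submission
  imports Defs
begin

text \<open>
  Definiteness is a statement about the values of a quadratic form on all nonzero vectors, and
  an invertible matrix \<open>T\<close> merely permutes these vectors. Since
  \<open>x \<bullet> (T\<^sup>T M T) x = (T x) \<bullet> M (T x)\<close>, the matrices \<open>M\<close> and \<open>T\<^sup>T M T\<close> are therefore negative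
  definite together (\<open>neg_def_congruence\<close>).

  It remains to see that \<open>\<Sigma> = diag(Q, Q, I, I)\<close> is invertible and that \<open>\<Sigma>\<^sup>T M \<Sigma>\<close> is the second
  matrix. Flattening turns block-wise multiplication and transposition into the ordinary ones
  (\<open>block_mat_mult\<close>, \<open>transpose_block_mat\<close>), so both facts can be checked block by block
  (\<open>invertible_block_diag\<close>, \<open>lmi_congruence\<close>).
  An inverse of \<open>\<Sigma>\<close> is \<open>diag(X, X, I, I)\<close>. In the congruence the symmetry of \<open>Q\<close> and
  \<open>Q X = I\<close> give \<open>Q (- X + Y) Q = - Q + Q Y Q\<close> in the corner, and the last diagonal block
  \<open>- X\<^sup>-\<^sup>1\<close>, which is not affine in \<open>X\<close>, is \<open>- Q\<close> already: the substitution \<open>Q = X\<^sup>-\<^sup>1\<close> is what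
  linearises the inequality. It would leave the product \<open>Q Y Q\<close> in the first two diagonal blocks;
  taking that product as a variable of its own makes every block affine (\<open>lmi_QY_affine\<close>).
\<close>

section \<open>Definiteness\<close>

lemma matrix_inv_inverse:
  fixes A :: "'a::semiring_1^'n^'m"
  assumes "invertible A"
  shows "A ** matrix_inv A = mat 1" "matrix_inv A ** A = mat 1"
  using someI_ex[OF assms[unfolded invertible_def]] unfolding matrix_inv_def by auto

lemma pos_def_invertible:
  fixes S :: "real^'k^'k"
  assumes "pos_def S"
  shows "invertible S"
proof -
  have "x = 0" if "S *v x = 0" for x
    using assms that unfolding pos_def_def by force
  then show ?thesis
    by (simp add: invertible_left_inverse matrix_left_invertible_ker)
qed

text \<open>With \<open>x = S y\<close>, the form of \<open>S\<^sup>-\<^sup>1\<close> at \<open>x\<close> is the form of \<open>S\<close> at \<open>y\<close>.\<close>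

lemma pos_def_matrix_inv:
  fixes S :: "real^'k^'k"
  assumes "pos_def S"
  shows "pos_def (matrix_inv S)"
proof -
  let ?R = "matrix_inv S"
  have inv: "S ** ?R = mat 1" "?R ** S = mat 1"
    using matrix_inv_inverse[OF pos_def_invertible[OF assms]] by auto
  have sym: "transpose S = S"
    using assms by (simp add: pos_def_def)
  have "transpose ?R ** S = mat 1"
    using arg_cong[OF inv(1), of transpose] by (simp add: matrix_transpose_mul sym)
  then have "transpose ?R = ?R"
    by (metis inv(1) matrix_mul_assoc matrix_mul_lid matrix_mul_rid)
  moreover have "x \<bullet> (?R *v x) > 0" if "x \<noteq> 0" for x
  proof -
    have x: "S *v (?R *v x) = x"
      by (simp add: matrix_vector_mul_assoc inv)
    then have "?R *v x \<noteq> 0"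
      using that by auto
    then have "(?R *v x) \<bullet> (S *v (?R *v x)) > 0"
      using assms by (simp add: pos_def_def)
    then show ?thesis
      by (simp add: x inner_commute)
  qed
  ultimately show ?thesis
    by (simp add: pos_def_def)
qed

lemma neg_def_congruence_imp:
  fixes M T :: "real^'k^'k"
  assumes "invertible T" "neg_def M"
  shows "neg_def (transpose T ** M ** T)"
proof -
  have "x \<bullet> ((transpose T ** M ** T) *v x) < 0" if "x \<noteq> 0" for x
  proof -
    have "T *v x \<noteq> 0"
      using assms(1) that by (metis invertible_left_inverse matrix_left_invertible_ker)
    then have "(T *v x) \<bullet> (M *v (T *v x)) < 0"
      using assms(2) by (simp add: neg_def_def)
    moreover have "x \<bullet> ((transpose T ** M ** T) *v x) = (T *v x) \<bullet> (M *v (T *v x))"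
      by (metis dot_lmul_matrix inner_commute matrix_vector_mul_assoc transpose_matrix_vector)
    ultimately show ?thesis
      by simp
  qed
  then show ?thesis
    using assms(2) by (simp add: neg_def_def matrix_transpose_mul matrix_mul_assoc)
qed

text \<open>The converse direction is the same implication for the congruence by \<open>T\<^sup>-\<^sup>1\<close>, which undoes
  the one by \<open>T\<close>.\<close>

lemma neg_def_congruence:
  fixes M T :: "real^'k^'k"
  assumes "invertible T"
  shows "neg_def (transpose T ** M ** T) \<longleftrightarrow> neg_def M"
proof
  let ?U = "matrix_inv T"
  note inv = matrix_inv_inverse[OF assms]
  have "invertible ?U"
    using inv by (auto simp: invertible_def)
  moreover assume "neg_def (transpose T ** M ** T)"
  ultimately have "neg_def (transpose ?U ** (transpose T ** M ** T) ** ?U)"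
    by (rule neg_def_congruence_imp)
  also have "transpose ?U ** (transpose T ** M ** T) ** ?U
      = transpose (T ** ?U) ** M ** (T ** ?U)"
    by (simp add: matrix_transpose_mul matrix_mul_assoc)
  also have "\<dots> = M"
    by (simp add: inv)
  finally show "neg_def M" .
qed (rule neg_def_congruence_imp[OF assms])

section \<open>Block matrices\<close>

lemma vector_4:
  "(vector [x, y, z, u] :: 'a::zero^4) $ 1 = x"
  "(vector [x, y, z, u] :: 'a::zero^4) $ 2 = y"
  "(vector [x, y, z, u] :: 'a::zero^4) $ 3 = z"
  "(vector [x, y, z, u] :: 'a::zero^4) $ 4 = u"
  unfolding vector_def by simp_all

lemma block_mat_mult:
  "block_mat M ** block_mat N = block_mat (\<chi> i j. \<Sum>k\<in>UNIV. M $ i $ k ** N $ k $ j)"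
  by (simp add: block_mat_def matrix_matrix_mult_def vec_eq_iff UNIV_Times_UNIV[symmetric]
      sum.cartesian_product case_prod_beta del: UNIV_Times_UNIV)

lemma transpose_block_mat:
  "transpose (block_mat M) = block_mat (\<chi> i j. transpose (M $ j $ i))"
  by (simp add: block_mat_def transpose_def vec_eq_iff)

lemma matrix_mult_zero_left: "(0 :: 'a::semiring_1^'n^'m) ** A = 0"
  by (simp add: matrix_matrix_mult_def vec_eq_iff)

lemma matrix_mult_zero_right: "A ** (0 :: 'a::semiring_1^'n^'m) = 0"
  by (simp add: matrix_matrix_mult_def vec_eq_iff)

lemma matrix_mult_minus_left: "(- A :: 'a::ring_1^'n^'m) ** B = - (A ** B)"
  by (simp add: matrix_matrix_mult_def vec_eq_iff sum_negf)

lemma matrix_mult_minus_right: "A ** (- B :: 'a::ring_1^'n^'m) = - (A ** B)"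
  by (simp add: matrix_matrix_mult_def vec_eq_iff sum_negf)

lemma matrix_mult_add_left: "(A + B :: 'a::semiring_1^'n^'m) ** C = A ** C + B ** C"
  by (simp add: matrix_matrix_mult_def vec_eq_iff distrib_right sum.distrib)

lemma transpose_zero: "transpose 0 = 0"
  by (simp add: transpose_def vec_eq_iff)

lemmas block_simps = vector_4 forall_4 sum_4 matrix_mult_zero_left matrix_mult_zero_right
  transpose_zero

lemma block_mat_one: "block_mat (block_diag (mat 1) (mat 1) (mat 1) (mat 1))
    = (mat 1 :: real^(4 \<times> 'n::finite)^(4 \<times> 'n))"
proof -
  let ?I = "block_diag (mat 1) (mat 1) (mat 1) (mat 1) :: real^'n^'n^4^4"
  have "\<forall>i j. ?I $ i $ j = (if i = j then mat 1 else 0)"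
    by (simp add: block_diag_def block_simps)
  then have I: "?I $ i $ j = (if i = j then mat 1 else 0)" for i j
    by blast
  show ?thesis
    unfolding block_mat_def I by (auto simp: vec_eq_iff mat_def)
qed

text \<open>Below, extensionality is instantiated to vectors indexed by \<open>4\<close>: two block arrays are compared
  block by block, and the blocks themselves stay whole.\<close>

lemma block_diag_mult:
  "block_mat (block_diag E F G H) ** block_mat (block_diag E' F' G' H')
    = block_mat (block_diag (E ** E') (F ** F') (G ** G') (H ** H'))"
  unfolding block_mat_mult
  by (rule arg_cong[of _ _ block_mat]) (simp add: vec_eq_iff[where 'b = 4] block_diag_def block_simps)

lemma transpose_block_diag:
  "transpose (block_mat (block_diag E F G H))
    = block_mat (block_diag (transpose E) (transpose F) (transpose G) (transpose H))"
  unfolding transpose_block_mat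
  by (rule arg_cong[of _ _ block_mat]) (simp add: vec_eq_iff[where 'b = 4] block_diag_def block_simps)

lemma invertible_block_diag:
  assumes "invertible E" "invertible F" "invertible G" "invertible H"
  shows "invertible (block_mat (block_diag E F G H))"
  unfolding invertible_right_inverse
  by (rule exI[of _ "block_mat (block_diag (matrix_inv E) (matrix_inv F)
      (matrix_inv G) (matrix_inv H))"])
    (simp add: block_diag_mult matrix_inv_inverse assms block_mat_one)

section \<open>The linear matrix inequality\<close>

lemma lmi_congruence:
  fixes X Y Q Ab Adb Db :: "real^'n^'n"
  assumes QX: "Q ** X = mat 1" and sym: "transpose Q = Q" and Q: "matrix_inv X = Q"
  defines "S \<equiv> block_mat (block_diag Q Q (mat 1) (mat 1))"
  shows "transpose S ** block_mat (lmi_XY Ab Adb Db \<gamma> X Y) ** S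
    = block_mat (lmi_QY Ab Adb Db \<gamma> Q (Q ** Y ** Q))"
proof -
  have "Q ** (- X + Y) ** Q = - Q + Q ** Y ** Q"
    by (simp add: matrix_add_ldistrib matrix_mult_add_left matrix_mult_minus_left
        matrix_mult_minus_right QX del: uminus_add_conv_diff)
  then show ?thesis
    unfolding S_def transpose_block_diag sym transpose_mat block_mat_mult
    by (intro arg_cong[of _ _ block_mat])
      (simp add: vec_eq_iff[where 'b = 4] block_diag_def lmi_XY_def lmi_QY_def block_simps Q
        matrix_mult_minus_left matrix_mult_minus_right)
qed

lemma affine_map_linear: "linear f \<Longrightarrow> affine_map f"
  unfolding affine_map_def by (intro exI[of _ f] exI[of _ 0]) simp

lemma affine_map_const: "affine_map (\<lambda>x. c)"
  unfolding affine_map_def by (intro exI[of _ "\<lambda>x. 0"] exI[of _ c]) (simp add: linearI)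

lemma lmi_QY_affine:
  fixes Ab Adb Db :: "real^'n^'n"
  shows "affine_map (\<lambda>(Q, Yt). lmi_QY Ab Adb Db \<gamma> Q Yt $ i $ j)"
proof -
  have "linear (\<lambda>p :: (real^'n^'n) \<times> (real^'n^'n). - fst p + snd p)"
    "linear (\<lambda>p :: (real^'n^'n) \<times> (real^'n^'n). - fst p)"
    "linear (\<lambda>p :: (real^'n^'n) \<times> (real^'n^'n). - snd p)"
    by (auto intro!: linearI simp: algebra_simps)
  moreover have "linear (\<lambda>p :: (real^'n^'n) \<times> (real^'n^'n). fst p ** M)"
    "linear (\<lambda>p :: (real^'n^'n) \<times> (real^'n^'n). M ** fst p)" for M
    by (auto intro!: linearI simp: matrix_add_ldistrib matrix_mult_add_left
        matrix_scalar_ac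
        scalar_matrix_assoc[symmetric])
  ultimately have "\<forall>i j. affine_map (\<lambda>(Q, Yt). lmi_QY Ab Adb Db \<gamma> Q Yt $ i $ j)"
    by (simp add: lmi_QY_def block_simps case_prod_unfold affine_map_const affine_map_linear)
  then show ?thesis
    by blast
qed

theorem mainTheorem2:
  fixes P :: "complex^'n^'n \<Rightarrow> complex^'n^'n"
    and w \<gamma> :: real
    and A Ad B C D AP AdP BP PI Ab Adb Db X Y Q Yt :: "real^'n^'n"
    and \<Sigma> :: "real^(4 \<times> 'n)^(4 \<times> 'n)"
  assumes rb: "rota_baxter w P"
    and AP: "P (complexify A) = complexify AP"
    and AdP: "P (complexify Ad) = complexify AdP"
    and BP: "P (complexify B) = complexify BP"
    and CBP: "invertible (C ** BP)"
    and PI: "PI = mat 1 - BP ** matrix_inv (C ** BP) ** C"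
    and Ab: "Ab = PI ** AP"
    and Adb: "Adb = PI ** AdP"
    and Db: "Db = PI ** D"
    and X: "pos_def X"
    and Y: "pos_def Y"
    and \<gamma>: "\<gamma> > 0"
    and Q: "Q = matrix_inv X"
    and Yt: "Yt = Q ** Y ** Q"
    and \<Sigma>: "\<Sigma> = block_mat (block_diag Q Q (mat 1) (mat 1))"
  shows "pos_def Q
    \<and> invertible \<Sigma>
    \<and> block_mat (lmi_QY Ab Adb Db \<gamma> Q Yt)
           = transpose \<Sigma> ** block_mat (lmi_XY Ab Adb Db \<gamma> X Y) ** \<Sigma>
    \<and> (neg_def (block_mat (lmi_XY Ab Adb Db \<gamma> X Y))
           \<longleftrightarrow> neg_def (block_mat (lmi_QY Ab Adb Db \<gamma> Q Yt)))
    \<and> (\<forall>i j. affine_map (\<lambda>(Q', Yt'). lmi_QY Ab Adb Db \<gamma> Q' Yt' $ i $ j))"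
proof (intro conjI allI)
  have inv: "Q ** X = mat 1" "X ** Q = mat 1"
    using matrix_inv_inverse[OF pos_def_invertible[OF X]] Q by auto
  show posQ: "pos_def Q"
    using pos_def_matrix_inv[OF X] Q by simp
  show inv\<Sigma>: "invertible \<Sigma>"
    unfolding \<Sigma> using inv
    by (intro invertible_block_diag) (auto simp: invertible_def intro: exI[of _ "mat 1"])
  show eq: "block_mat (lmi_QY Ab Adb Db \<gamma> Q Yt)
      = transpose \<Sigma> ** block_mat (lmi_XY Ab Adb Db \<gamma> X Y) ** \<Sigma>"
    unfolding \<Sigma> Yt using inv(1) posQ Q by (simp add: lmi_congruence pos_def_def)
  show "neg_def (block_mat (lmi_XY Ab Adb Db \<gamma> X Y))
      \<longleftrightarrow> neg_def (block_mat (lmi_QY Ab Adb Db \<gamma> Q Yt))"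
    unfolding eq by (rule neg_def_congruence[OF inv\<Sigma>, symmetric])
  show "affine_map (\<lambda>(Q', Yt'). lmi_QY Ab Adb Db \<gamma> Q' Yt' $ i $ j)" for i j
    by (rule lmi_QY_affine)
qed

end
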